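(* Let $(S,\triangleright)$ be a left shelf, let $(T,\triangleleft)$ be a right rack, and let $r_S$ and $r_T$ be the solutions associated with them, i.e. $r_S(a,b)=(b,\,b\triangleright a)$ and $r_T(u,v)=(v\triangleleft u,\,u)$. If $(r_S,r_T,\alpha,\beta)$ is a matched product system of solutions, then the structure shelf operation of the matched product solution $r:=r_S\bowtie r_T$ is $$(a,u)\triangleright_{r}(b,v)=(a\triangleright b,\ v\triangleleft u)$$ for all $a,b\in S$ and $u,v\in T$.
   Context: Solutions. A (set-theoretical) solution on a set $X$ is a map $r:X\times X\to X\times X$ with $(r\times\mathrm{id}_X)(\mathrm{id}_X\times r)(r\times\mathrm{id}_X)=(\mathrm{id}_X\times r)(r\times\mathrm{id}_X)(\mathrm{id}_X\times r)$. Write $r(x,y)=(\lambda_x(y),\rho_y(x))$. The solution $r$ is left non-degenerate if every $\lambda_x$ is bijective. Shelves. A left shelf is a set $X$ with a binary operation $\triangleright$ such that $x\triangleright(y\triangleright z)=(x\triangleright y)\triangleright(x\triangleright z)$ for all $x,y,z$; its associated solution is $r_\triangleright(x,y)=(y,\,y\triangleright x)$. A right shelf is a set $X$ with a binary operation $\triangleleft$ such that $(x\triangleleft y)\triangleleft z=(x\triangleleft z)\triangleleft(y\triangleleft z)$ for all $x,y,z$; its associated solution is $r_\triangleleft(x,y)=(y\triangleleft x,\,x)$. A right rack is a right shelf in which every map $R_y:X\to X$, $R_y(x)=x\triangleleft y$, is bijective. Structure shelf. If $r$ is a left non-degenerate solution on $X$, its structure shelf is $X$ with the operation $x\triangleright_r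 y:=\lambda_x\big(\rho_{\lambda_y^{-1}(x)}(y)\big)$. (In the present situation the matched product solution is left non-degenerate, so this applies.) $\mathrm{Sym}(X)$ is the group of bijections $X\to X$; juxtaposition of maps is composition, $fg=f\circ g$. Matched product systems. Given solutions $r_S$ on $S$ and $r_T$ on $T$ (components of both written $\lambda,\rho$, with $a,b\in S$ and $u,v\in T$) and maps $\alpha:T\to\mathrm{Sym}(S)$, $\beta:S\to\mathrm{Sym}(T)$, with $\alpha_u:=\alpha(u)$, $\beta_a:=\beta(a)$, the quadruple $(r_S,r_T,\alpha,\beta)$ is a matched product system of solutions if for all $a,b\in S$, $u,v\in T$: (s1) $\alpha_u\alpha_v=\alpha_{\lambda_u(v)}\alpha_{\rho_v(u)}$; (s2) $\beta_a\beta_b=\beta_{\lambda_a(b)}\beta_{\rho_b(a)}$; (s3) $\rho_{\alpha_u^{-1}(b)}\big(\alpha^{-1}_{\beta_a(u)}(a)\big)=\alpha^{-1}_{\beta_{\rho_b(a)}\beta_b^{-1}(u)}\big(\rho_b(a)\big)$; (s4) $\rho_{\beta_a^{-1}(v)}\big(\beta^{-1}_{\alpha_u(a)}(u)\big)=\beta^{-1}_{\alpha_{\rho_v(u)}\alpha_v^{-1}(a)}\big(\rho_v(u)\big)$; (s5) $\lambda_a\alpha_{\beta_a^{-1}(u)}=\alpha_u\lambda_{\alpha_u^{-1}(a)}$; (s6) $\lambda_u\beta_{\alpha_u^{-1}(a)}=\beta_a\lambda_{\beta_a^{-1}(u)}$. Matched product. For a matched product system, the matched product solution $r_S\bowtie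 r_T$ is the map on $(S\times T)\times(S\times T)$ (known to be a solution on $S\times T$) $$\big((a,u),(b,v)\big)\mapsto\Big(\big(A,U\big),\ \big(\alpha^{-1}_{\overline U}(\rho_{\alpha_{\bar u}(b)}(a)),\ \beta^{-1}_{\overline A}(\rho_{\beta_{\bar a}(v)}(u))\big)\Big),$$ where $\bar a=\alpha_u^{-1}(a)$, $\bar u=\beta_a^{-1}(u)$, $A=\alpha_u(\lambda_{\bar a}(b))$, $U=\beta_a(\lambda_{\bar u}(v))$, $\overline A=\alpha_U^{-1}(A)$, $\overline U=\beta_A^{-1}(U)$. *)

theory Defs
  imports Main
begin

text \<open>
  The sets carrying solutions and shelves are represented by types. For
  \<open>r (x, y) = (\<lambda>\<^sub>x(y), \<rho>\<^sub>y(x))\<close> the components are written \<open>lam r x y\<close> and \<open>rho r y x\<close>,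
  the subscript coming first in both.
\<close>

definition lam :: "('x \<times> 'x \<Rightarrow> 'x \<times> 'x) \<Rightarrow> 'x \<Rightarrow> 'x \<Rightarrow> 'x" where
  "lam r x y = fst (r (x, y))"

definition rho :: "('x \<times> 'x \<Rightarrow> 'x \<times> 'x) \<Rightarrow> 'x \<Rightarrow> 'x \<Rightarrow> 'x" where
  "rho r y x = snd (r (x, y))"

definition times_id :: "('x \<times> 'x \<Rightarrow> 'x \<times> 'x) \<Rightarrow> 'x \<times> 'x \<times> 'x \<Rightarrow> 'x \<times> 'x \<times> 'x" where
  "times_id r = (\<lambda>(x, y, z). (fst (r (x, y)), snd (r (x, y)), z))"

definition id_times :: "('x \<times> 'x \<Rightarrow> 'x \<times> 'x) \<Rightarrow> 'x \<times> 'x \<times> 'x \<Rightarrow> 'x \<times> 'x \<times> 'x" where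
  "id_times r = (\<lambda>(x, y, z). (x, r (y, z)))"

definition solution :: "('x \<times> 'x \<Rightarrow> 'x \<times> 'x) \<Rightarrow> bool" where
  "solution r \<longleftrightarrow>
    times_id r \<circ> id_times r \<circ> times_id r = id_times r \<circ> times_id r \<circ> id_times r"

definition left_nondegenerate :: "('x \<times> 'x \<Rightarrow> 'x \<times> 'x) \<Rightarrow> bool" where
  "left_nondegenerate r \<longleftrightarrow> (\<forall>x. bij (lam r x))"

definition left_shelf :: "('x \<Rightarrow> 'x \<Rightarrow> 'x) \<Rightarrow> bool" where
  "left_shelf f \<longleftrightarrow> (\<forall>x y z. f x (f y z) = f (f x y) (f x z))"

definition right_shelf :: "('x \<Rightarrow> 'x \<Rightarrow> 'x) \<Rightarrow> bool" where
  "right_shelf f \<longleftrightarrow> (\<forall>x y z. f (f x y) z = f (f x z) (f y z))"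

definition right_rack :: "('x \<Rightarrow> 'x \<Rightarrow> 'x) \<Rightarrow> bool" where
  "right_rack f \<longleftrightarrow> right_shelf f \<and> (\<forall>y. bij (\<lambda>x. f x y))"

definition left_shelf_solution :: "('x \<Rightarrow> 'x \<Rightarrow> 'x) \<Rightarrow> 'x \<times> 'x \<Rightarrow> 'x \<times> 'x" where
  "left_shelf_solution f = (\<lambda>(x, y). (y, f y x))"

definition right_shelf_solution :: "('x \<Rightarrow> 'x \<Rightarrow> 'x) \<Rightarrow> 'x \<times> 'x \<Rightarrow> 'x \<times> 'x" where
  "right_shelf_solution f = (\<lambda>(x, y). (f y x, x))"

text \<open>Meaningful only for left non-degenerate \<open>r\<close>, where \<open>inv\<close> is a genuine inverse.\<close>

definition structure_shelf :: "('x \<times> 'x \<Rightarrow> 'x \<times> 'x) \<Rightarrow> 'x \<Rightarrow> 'x \<Rightarrow> 'x" where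
  "structure_shelf r x y = lam r x (rho r (inv (lam r y) x) y)"

locale matched_product_system =
  fixes rS :: "'s \<times> 's \<Rightarrow> 's \<times> 's"
    and rT :: "'t \<times> 't \<Rightarrow> 't \<times> 't"
    and \<alpha> :: "'t \<Rightarrow> 's \<Rightarrow> 's"
    and \<beta> :: "'s \<Rightarrow> 't \<Rightarrow> 't"
  assumes solution_S: "solution rS"
    and solution_T: "solution rT"
    and bij_alpha: "bij (\<alpha> u)"
    and bij_beta: "bij (\<beta> a)"
    and s1: "\<alpha> u \<circ> \<alpha> v = \<alpha> (lam rT u v) \<circ> \<alpha> (rho rT v u)"
    and s2: "\<beta> a \<circ> \<beta> b = \<beta> (lam rS a b) \<circ> \<beta> (rho rS b a)"
    and s3: "rho rS (inv (\<alpha> u) b) (inv (\<alpha> (\<beta> a u)) a) =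
             inv (\<alpha> (\<beta> (rho rS b a) (inv (\<beta> b) u))) (rho rS b a)"
    and s4: "rho rT (inv (\<beta> a) v) (inv (\<beta> (\<alpha> u a)) u) =
             inv (\<beta> (\<alpha> (rho rT v u) (inv (\<alpha> v) a))) (rho rT v u)"
    and s5: "lam rS a \<circ> \<alpha> (inv (\<beta> a) u) = \<alpha> u \<circ> lam rS (inv (\<alpha> u) a)"
    and s6: "lam rT u \<circ> \<beta> (inv (\<alpha> u) a) = \<beta> a \<circ> lam rT (inv (\<beta> a) u)"

definition matched_product ::
  "('s \<times> 's \<Rightarrow> 's \<times> 's) \<Rightarrow> ('t \<times> 't \<Rightarrow> 't \<times> 't) \<Rightarrow> ('t \<Rightarrow> 's \<Rightarrow> 's) \<Rightarrow> ('s \<Rightarrow> 't \<Rightarrow> 't) \<Rightarrow>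
   ('s \<times> 't) \<times> ('s \<times> 't) \<Rightarrow> ('s \<times> 't) \<times> ('s \<times> 't)" where
  "matched_product rS rT \<alpha> \<beta> = (\<lambda>((a, u), (b, v)).
     let a' = inv (\<alpha> u) a;
         u' = inv (\<beta> a) u;
         A = \<alpha> u (lam rS a' b);
         U = \<beta> a (lam rT u' v);
         A' = inv (\<alpha> U) A;
         U' = inv (\<beta> A) U
     in ((A, U), (inv (\<alpha> U') (rho rS (\<alpha> u' b) a), inv (\<beta> A') (rho rT (\<beta> a' v) u))))"

lemma solution_left_shelf_solution: "left_shelf f \<Longrightarrow> solution (left_shelf_solution f)"
  by (auto simp: left_shelf_def solution_def left_shelf_solution_def times_id_def id_times_def
      fun_eq_iff)

lemma solution_right_shelf_solution: "right_shelf f \<Longrightarrow> solution (right_shelf_solution f)"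
  by (auto simp: right_shelf_def solution_def right_shelf_solution_def times_id_def id_times_def
      fun_eq_iff)

lemma left_nondegenerate_left_shelf_solution: "left_nondegenerate (left_shelf_solution f)"
  by (simp add: left_nondegenerate_def lam_def [abs_def] left_shelf_solution_def bij_def inj_def surj_def)

lemma left_nondegenerate_right_shelf_solution:
  "right_rack f \<Longrightarrow> left_nondegenerate (right_shelf_solution f)"
  by (simp add: left_nondegenerate_def lam_def [abs_def] right_shelf_solution_def right_rack_def)

lemma (in matched_product_system) left_nondegenerate_matched_product:
  assumes "left_nondegenerate rS" and "left_nondegenerate rT"
  shows "left_nondegenerate (matched_product rS rT \<alpha> \<beta>)"
proof -
  have "bij (lam (matched_product rS rT \<alpha> \<beta>) (a, u))" for a u
  proof -
    have "lam (matched_product rS rT \<alpha> \<beta>) (a, u) =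
        map_prod (\<alpha> u \<circ> lam rS (inv (\<alpha> u) a)) (\<beta> a \<circ> lam rT (inv (\<beta> a) u))"
      by (auto simp: fun_eq_iff lam_def matched_product_def Let_def)
    moreover have "bij (\<alpha> u \<circ> lam rS (inv (\<alpha> u) a))" "bij (\<beta> a \<circ> lam rT (inv (\<beta> a) u))"
      using assms bij_alpha bij_beta by (auto simp: left_nondegenerate_def intro: bij_comp)
    ultimately show ?thesis
      by (metis bij_def map_prod_surj prod.inj_map)
  qed
  then show ?thesis
    by (auto simp: left_nondegenerate_def)
qed

end

theory Submission
  imports Defs
begin

text \<open>
  The structure shelf of a matched product of left non-degenerate solutions is the direct product
  of the structure shelves of the two factors, whatever the actions \<open>\<alpha>\<close> and \<open>\<beta>\<close> are
  (\<open>structure_shelf_matched_product\<close>).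
  By (s5) and (s6) the \<open>\<lambda>\<close>-map of the matched product at \<open>(a, u)\<close> is \<open>\<lambda>\<^sub>a \<times> \<lambda>\<^sub>u\<close> precomposed with
  the twist \<open>\<alpha>\<^bsub>\<beta>\<^sub>a\<inverse>(u)\<^esub> \<times> \<beta>\<^bsub>\<alpha>\<^sub>u\<inverse>(a)\<^esub>\<close>.  In \<open>\<lambda>\<^sub>x(\<rho>\<^sub>z(y))\<close>, where \<open>z = \<lambda>\<^sub>y\<inverse>(x)\<close>, twists occur twice.
  One is applied to \<open>z\<close> inside \<open>\<rho>\<close>, and it turns the components of \<open>z\<close> into the untwisted preimages
  under the \<open>\<lambda>\<close>-maps of the factors.  The other belongs to the outer \<open>\<lambda>\<^sub>x\<close>, and it cancels against
  the inverse twist in the definition of \<open>\<rho>\<close>, because \<open>\<lambda>\<^sub>y(z) = x\<close> makes both of them the twist at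
  \<open>x\<close>.

  The theorem then needs only the structure shelves of the two factors: a left shelf gives back its
  own operation, since its \<open>\<lambda>\<close>-maps are identities, and a right rack gives the operation with its
  arguments exchanged, since its \<open>\<rho>\<close>-maps are identities.
\<close>

lemma structure_shelf_left_shelf_solution:
  "structure_shelf (left_shelf_solution f) a b = f a b"
proof -
  have "lam (left_shelf_solution f) b = id"
    by (simp add: fun_eq_iff lam_def left_shelf_solution_def)
  then show ?thesis
    by (simp add: structure_shelf_def lam_def rho_def left_shelf_solution_def)
qed

lemma structure_shelf_right_shelf_solution:
  "structure_shelf (right_shelf_solution f) u v = f v u"
  by (simp add: structure_shelf_def lam_def rho_def right_shelf_solution_def)

context matched_product_system
begin

text \<open>
  Conditions (s5) and (s6) move the \<open>\<lambda>\<close>-maps of the factors to the outside, where they carry no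
  twisted index.
\<close>

lemma lam_matched_product:
  "lam (matched_product rS rT \<alpha> \<beta>) (a, u) (b, v) =
    (lam rS a (\<alpha> (inv (\<beta> a) u) b), lam rT u (\<beta> (inv (\<alpha> u) a) v))"
  using fun_cong [OF s5, of a u b] fun_cong [OF s6, of u a v]
  by (simp add: lam_def matched_product_def Let_def)

text \<open>
  Expressing \<open>\<rho>\<close> through the value \<open>(A, U)\<close> of \<open>\<lambda>\<close> shows that the outer inverses are those of the
  twist at \<open>(A, U)\<close>.
\<close>

lemma rho_matched_product:
  assumes "lam (matched_product rS rT \<alpha> \<beta>) (a, u) (b, v) = (A, U)"
  shows "rho (matched_product rS rT \<alpha> \<beta>) (b, v) (a, u) =
    (inv (\<alpha> (inv (\<beta> A) U)) (rho rS (\<alpha> (inv (\<beta> a) u) b) a),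
     inv (\<beta> (inv (\<alpha> U) A)) (rho rT (\<beta> (inv (\<alpha> u) a) v) u))"
  using assms by (simp add: lam_def rho_def matched_product_def Let_def)

theorem structure_shelf_matched_product:
  assumes S: "left_nondegenerate rS" and T: "left_nondegenerate rT"
  shows "structure_shelf (matched_product rS rT \<alpha> \<beta>) (a, u) (b, v) =
    (structure_shelf rS a b, structure_shelf rT u v)"
proof -
  let ?r = "matched_product rS rT \<alpha> \<beta>"
  obtain c w where cw: "inv (lam ?r (b, v)) (a, u) = (c, w)"
    by fastforce
  have "bij (lam ?r (b, v))"
    using left_nondegenerate_matched_product [OF S T] by (simp add: left_nondegenerate_def)
  then have preimage: "lam ?r (b, v) (c, w) = (a, u)"
    by (metis bij_inv_eq_iff cw)
  \<comment> \<open>The inner twist turns \<open>c\<close> and \<open>w\<close> into preimages under the \<open>\<lambda>\<close>-maps of the factors.\<close>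
  have "\<alpha> (inv (\<beta> b) v) c = inv (lam rS b) a" and "\<beta> (inv (\<alpha> v) b) w = inv (lam rT v) u"
    using preimage S T by (auto simp: lam_matched_product left_nondegenerate_def bij_is_inj)
  then have "structure_shelf ?r (a, u) (b, v) =
      lam ?r (a, u)
        (inv (\<alpha> (inv (\<beta> a) u)) (rho rS (inv (lam rS b) a) b),
         inv (\<beta> (inv (\<alpha> u) a)) (rho rT (inv (lam rT v) u) v))"
    by (simp add: structure_shelf_def cw rho_matched_product [OF preimage])
  \<comment> \<open>The twist in the outer \<open>\<lambda>\<close> cancels these inverses.\<close>
  then show ?thesis
    by (simp add: lam_matched_product structure_shelf_def bij_alpha bij_beta
        bij_is_surj surj_f_inv_f)
qed

end

theorem proposition9:
  fixes shS :: "'s \<Rightarrow> 's \<Rightarrow> 's" (infix "\<rhd>" 70)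
    and shT :: "'t \<Rightarrow> 't \<Rightarrow> 't" (infix "\<lhd>" 70)
    and \<alpha> :: "'t \<Rightarrow> 's \<Rightarrow> 's"
    and \<beta> :: "'s \<Rightarrow> 't \<Rightarrow> 't"
  assumes "left_shelf (\<rhd>)"
    and "right_rack (\<lhd>)"
    and "matched_product_system (left_shelf_solution (\<rhd>)) (right_shelf_solution (\<lhd>)) \<alpha> \<beta>"
  shows "\<forall>a b u v.
    structure_shelf
      (matched_product (left_shelf_solution (\<rhd>)) (right_shelf_solution (\<lhd>)) \<alpha> \<beta>) (a, u) (b, v) =
    (a \<rhd> b, v \<lhd> u)"
proof -
  interpret matched_product_system "left_shelf_solution (\<rhd>)" "right_shelf_solution (\<lhd>)" \<alpha> \<beta>
    by fact
  show ?thesis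
    using structure_shelf_matched_product [OF left_nondegenerate_left_shelf_solution
        left_nondegenerate_right_shelf_solution [OF assms(2)]]
    by (simp add: structure_shelf_left_shelf_solution structure_shelf_right_shelf_solution)
qed

end
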